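(* Let $q=2^m$ and let $g:S\to F$ be a function with $g(u)\neq 0$ for all $u\in S$. Let $H=\{u/g(u): u\in S\}\cup\{0\}$ and for a positive integer $d$ let $\pi_d=\sum_{u\in S}(u/g(u))^d$. Let $$\mathscr{M}=\{(i,k): 1\le k\le q-2,\ 0\le i\le \lfloor (k-1)/2\rfloor,\ i\preceq k\},\qquad D=\{iq+k-i: (i,k)\in\mathscr{M}\}.$$ Then $H$ is a hyperoval if and only if $\pi_d=0$ for all $d\in D$.
   Context: Let $q=2^m$, $F=\mathbb{F}_q$, $K=\mathbb{F}_{q^2}$, and for $x\in K$ write $\bar x=x^q$. Let $S=\{u\in K: u^{q+1}=1\}$ and define the $F$-valued bilinear form $\langle x,y\rangle=x\bar y+\bar x y$ on $K$. The affine plane $AG(2,q)$ is identified with $K$: its points are the elements of $K$ and its lines are the sets $L(u,\mu)=\{x\in K:\langle u,x\rangle+\mu=0\}$ with $u\in S$, $\mu\in F$. A hyperoval is a set of $q+2$ points of $K$, no three of which lie on a common line. For nonnegative integers $b=\sum_j b_j2^j$, $c=\sum_j c_j2^j$ with $b_j,c_j\in\{0,1\}$, write $b\preceq c$ if $b_j\le c_j$ for all $j$. *)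

theory Defs
  imports Main "HOL-Library.FuncSet" "HOL-Library.Cardinality"
begin

text \<open>
  Throughout, the type \<open>'a\<close> plays the role of the field K with \<open>q\<^sup>2\<close> elements;
  the definitions take \<open>q\<close> as a parameter and are meant for \<open>CARD('a) = q\<^sup>2\<close>.
\<close>

definition conj_q :: "nat \<Rightarrow> 'a::{field,finite} \<Rightarrow> 'a" where
  "conj_q q x = x ^ q"

text \<open>
  The field F with \<open>q\<close> elements is identified with the unique subfield of K of that order,
  whose elements are the roots of \<open>x\<^sup>q = x\<close>.
\<close>
definition subfield_F :: "nat \<Rightarrow> 'a::{field,finite} set" where
  "subfield_F q = {x. x ^ q = x}"

definition unit_circle :: "nat \<Rightarrow> 'a::{field,finite} set" where
  "unit_circle q = {u. u ^ (q + 1) = 1}"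

definition bform :: "nat \<Rightarrow> 'a::{field,finite} \<Rightarrow> 'a \<Rightarrow> 'a" where
  "bform q x y = x * conj_q q y + conj_q q x * y"

definition ag_line :: "nat \<Rightarrow> 'a::{field,finite} \<Rightarrow> 'a \<Rightarrow> 'a set" where
  "ag_line q u \<mu> = {x. bform q u x + \<mu> = 0}"

definition ag_lines :: "nat \<Rightarrow> 'a::{field,finite} set set" where
  "ag_lines q = {ag_line q u \<mu> | u \<mu>. u \<in> unit_circle q \<and> \<mu> \<in> subfield_F q}"

definition hyperoval :: "nat \<Rightarrow> 'a::{field,finite} set \<Rightarrow> bool" where
  "hyperoval q A \<longleftrightarrow> card A = q + 2 \<and>
     \<not> (\<exists>x\<in>A. \<exists>y\<in>A. \<exists>z\<in>A. x \<noteq> y \<and> x \<noteq> z \<and> y \<noteq> z \<and> (\<exists>l\<in>ag_lines q. {x, y, z} \<subseteq> l))"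

definition bin_le :: "nat \<Rightarrow> nat \<Rightarrow> bool" (infix "\<preceq>\<^sub>2" 50) where
  "b \<preceq>\<^sub>2 c \<longleftrightarrow> (\<forall>j. bit b j \<longrightarrow> bit c j)"

definition H_set :: "nat \<Rightarrow> ('a::{field,finite} \<Rightarrow> 'a) \<Rightarrow> 'a set" where
  "H_set q g = {u / g u | u. u \<in> unit_circle q} \<union> {0}"

definition power_sum :: "nat \<Rightarrow> ('a::{field,finite} \<Rightarrow> 'a) \<Rightarrow> nat \<Rightarrow> 'a" where
  "power_sum q g d = (\<Sum>u\<in>unit_circle q. (u / g u) ^ d)"

text \<open>
  The truncated subtractions and the rounding in \<open>div\<close> agree with the integer operations here:
  \<open>q \<ge> 2\<close>, \<open>k \<ge> 1\<close> and \<open>i \<le> k\<close>.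
\<close>
definition M_set :: "nat \<Rightarrow> (nat \<times> nat) set" where
  "M_set q = {(i, k). 1 \<le> k \<and> k \<le> q - 2 \<and> i \<le> (k - 1) div 2 \<and> i \<preceq>\<^sub>2 k}"

definition D_set :: "nat \<Rightarrow> nat set" where
  "D_set q = {i * q + k - i | i k. (i, k) \<in> M_set q}"

end

theory Submission
  imports Defs "HOL-Computational_Algebra.Polynomial" "HOL-Computational_Algebra.Primes"
begin

text \<open>
  A set of \<open>q + 2\<close> points is a hyperoval iff every line \<open>L(u, \<mu>)\<close> meets it in an even number of points.
  For fixed \<open>u\<close> all these parities are even iff \<open>\<Sum>x\<in>H. \<langle>u, x\<rangle>\<^sup>k = 0\<close> for \<open>1 \<le> k \<le> q - 2\<close>. Since \<open>u\<close> has inverse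
  \<open>u\<^sup>q\<close>, multiplying by \<open>u\<^sup>k\<close> and expanding turns this sum into \<open>\<Sum>i\<le>k. (k choose i) \<pi>\<^bsub>iq+k-i\<^esub> u\<^bsup>2i\<^esup>\<close>,
  which vanishes on \<open>S\<close> iff all its coefficients do. By Lucas only \<open>i \<preceq> k\<close> matter, and \<open>i\<close>, \<open>k - i\<close> give
  conjugate power sums.
\<close>

section \<open>Finite fields\<close>

lemma finite_field_power_card_minus_one:
  fixes x :: "'a::{field,finite}"
  assumes "x \<noteq> 0"
  shows "x ^ (CARD('a) - 1) = 1"
proof -
  have "(\<Prod>y\<in>UNIV-{0}. x * y) = (\<Prod>y\<in>UNIV-{0}. y)"
    by (rule prod.reindex_bij_witness[of _ "\<lambda>y. y / x" "\<lambda>y. x * y"]) (use assms in auto)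
  then have "x ^ (CARD('a) - 1) * \<Prod>(UNIV-{0::'a}) = \<Prod>(UNIV-{0})"
    by (simp add: prod.distrib card_Diff_singleton)
  then show ?thesis by simp
qed

lemma card_power_eq_le:
  fixes c :: "'a::{comm_ring_1,ring_no_zero_divisors}"
  assumes "n > 0"
  shows "card {x. x ^ n = c} \<le> n"
proof -
  let ?p = "monom 1 n - [:c:]"
  have "degree ?p = n"
  proof (rule antisym)
    show "degree ?p \<le> n"
      by (rule degree_diff_le) (auto simp: degree_monom_le)
    show "n \<le> degree ?p"
      using assms by (intro le_degree) (auto simp: coeff_pCons split: nat.splits)
  qed
  moreover from this have "?p \<noteq> 0" using assms by auto
  moreover have "{x. x ^ n = c} = {x. poly ?p x = 0}"
    by (simp add: poly_monom)
  ultimately show ?thesis using card_poly_roots_bound by metis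
qed

text \<open>The map \<open>x ^ b\<close> sends the \<open>a * b\<close> nonzero elements into the
  \<open>a\<close>-th roots of unity with fibres of size at most \<open>b\<close>, so there are at
  least \<open>a\<close> such roots; the degree bound gives at most \<open>a\<close>.\<close>

lemma card_roots_of_unity_finite_field:
  assumes "a * b = CARD('a::{field,finite}) - 1"
  shows "card {x::'a. x ^ a = 1} = a"
proof -
  have "card {0, 1::'a} \<le> CARD('a)" by (rule card_mono) auto
  then have pos: "a > 0" "b > 0" using assms by (auto intro!: Nat.gr0I)
  let ?R = "{x::'a. x ^ a = 1}"
  have "(- {0::'a}) \<subseteq> (\<Union>y\<in>?R. {x. x ^ b = y})"
  proof
    fix x :: 'a assume "x \<in> - {0}"
    then have "(x ^ b) ^ a = 1"
      using finite_field_power_card_minus_one[of x] assms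
      by (simp add: mult.commute flip: power_mult)
    then show "x \<in> (\<Union>y\<in>?R. {x. x ^ b = y})" by blast
  qed
  then have "card (- {0::'a}) \<le> card (\<Union>y\<in>?R. {x. x ^ b = y})"
    by (intro card_mono) auto
  also have "\<dots> \<le> (\<Sum>y\<in>?R. card {x. x ^ b = y})"
    by (rule card_UN_le) simp
  also have "\<dots> \<le> card ?R * b"
    using sum_bounded_above[of ?R "\<lambda>y. card {x. x ^ b = y}" b] card_power_eq_le[OF pos(2)] by auto
  finally have "a * b \<le> card ?R * b"
    using assms by (simp add: Compl_eq_Diff_UNIV card_Diff_singleton)
  then have "a \<le> card ?R" using pos by simp
  with card_power_eq_le[OF pos(1), of "1::'a"] show ?thesis by simp
qed

text \<open>Translation by 1 permutes the ring, so the sum of all elements absorbs the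
  cardinality.\<close>

lemma of_nat_CARD_eq_0: "of_nat CARD('a) = (0::'a::{ring_1,finite})"
proof -
  have "(\<Sum>x\<in>(UNIV::'a set). x + 1) = (\<Sum>x\<in>UNIV. x)"
    by (rule sum.reindex_bij_witness[of _ "\<lambda>y. y - 1" "\<lambda>y. y + 1"]) auto
  then show ?thesis by (simp add: sum.distrib)
qed

section \<open>Binomial coefficients modulo 2\<close>

lemma even_choose_double:
  "even ((2 * n) choose (2 * k)) = even (n choose k) \<and> even ((2 * n) choose Suc (2 * k))"
proof (induction n arbitrary: k)
  case 0
  then show ?case by (cases k) auto
next
  case (Suc n)
  show ?case
  proof (cases k)
    case 0
    then show ?thesis by simp
  next
    case (Suc j)
    \<comment> \<open>Pascal's rule applied twice: the middle term occurs doubled and drops out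
      modulo 2.\<close>
    have "2 * Suc n choose (2 * k) =
        (2 * n choose (2 * j)) + 2 * (2 * n choose Suc (2 * j)) + (2 * n choose (2 * k))"
      "2 * Suc n choose Suc (2 * k) =
        (2 * n choose Suc (2 * j)) + 2 * (2 * n choose (2 * k)) + (2 * n choose Suc (2 * k))"
      by (simp_all add: Suc)
    moreover have "Suc n choose k = (n choose j) + (n choose k)" by (simp add: Suc)
    ultimately show ?thesis using Suc.IH[of j] Suc.IH[of k] by simp
  qed
qed

lemma even_choose_Suc_double:
  "even (Suc (2 * n) choose (2 * k)) = even (n choose k)"
  "even (Suc (2 * n) choose Suc (2 * k)) = even (n choose k)"
  using even_choose_double[of n k] even_choose_double[of n "k - 1"]
  by (cases k; simp)+

text \<open>Lucas's theorem for the prime 2, by peeling off the lowest binary digits of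
  \<open>n\<close> and \<open>k\<close>.\<close>

lemma odd_choose_iff_bin_le: "odd (n choose k) \<longleftrightarrow> k \<preceq>\<^sub>2 n"
proof (induction n arbitrary: k rule: less_induct)
  case (less n)
  have step: "k \<preceq>\<^sub>2 n \<longleftrightarrow> (odd k \<longrightarrow> odd n) \<and> (k div 2) \<preceq>\<^sub>2 (n div 2)"
    unfolding bin_le_def by (metis bit_0 bit_Suc not0_implies_Suc)
  show ?case
  proof (cases "n = 0")
    case True
    moreover have "k \<preceq>\<^sub>2 0 \<longleftrightarrow> k = 0" by (simp add: bin_le_def bit_eq_iff)
    ultimately show ?thesis by (cases k) auto
  next
    case False
    then have IH: "odd (n div 2 choose k div 2) \<longleftrightarrow> (k div 2) \<preceq>\<^sub>2 (n div 2)"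
      by (intro less) auto
    obtain a where a: "n = 2 * a \<or> n = Suc (2 * a)" by (metis evenE oddE Suc_eq_plus1)
    obtain b where b: "k = 2 * b \<or> k = Suc (2 * b)" by (metis evenE oddE Suc_eq_plus1)
    from a b IH step show ?thesis
      by (auto simp: even_choose_double even_choose_Suc_double)
  qed
qed

text \<open>Pascal's rule splits it into two entries that are equal by symmetry.\<close>

lemma even_central_choose:
  assumes "k > 0"
  shows "even ((2 * k) choose k)"
proof -
  obtain j where j: "k = Suc j" using assms gr0_implies_Suc by blast
  have "Suc (2 * j) choose j = Suc (2 * j) choose Suc j"
    by (subst binomial_symmetric) auto
  then show ?thesis by (simp add: j)
qed

section \<open>The plane over a quadratic extension in characteristic 2\<close>

text \<open>The token \<open>K\<close> only makes the field type a parameter, so that an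
  interpretation can fix it.\<close>

locale quadratic_ext =
  fixes K :: "'a::{field,finite} itself" and m q :: nat
  assumes q_def: "q = 2 ^ m"
    and CARD_K: "CARD('a) = q ^ 2"
begin

abbreviation S :: "'a set" where "S \<equiv> unit_circle q"
abbreviation F :: "'a set" where "F \<equiv> subfield_F q"
abbreviation B :: "'a \<Rightarrow> 'a \<Rightarrow> 'a" where "B \<equiv> bform q"

lemma q_ge_2: "q \<ge> 2" and even_q: "even q"
proof -
  have "card {0, 1::'a} \<le> CARD('a)" by (rule card_mono) auto
  then have "m \<noteq> 0" using q_def CARD_K by (intro notI) simp
  then show "q \<ge> 2" "even q" unfolding q_def by (simp_all add: self_le_power)
qed

lemma CHAR_K: "CHAR('a) = 2"
proof -
  have "of_nat (2 ^ (m * 2)) = (0::'a)"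
    using of_nat_CARD_eq_0[where 'a='a] unfolding CARD_K q_def by (simp add: power_mult)
  then have "(2::'a) ^ (m * 2) = 0" by (simp del: power_mult)
  then have "of_nat 2 = (0::'a)" by simp
  then have "CHAR('a) dvd 2" by (subst (asm) of_nat_eq_0_iff_char_dvd)
  then show ?thesis
    using CHAR_not_1'[where 'a='a] prime_nat_iff[of 2] by auto
qed

lemma of_nat_K_eq_0_iff: "of_nat n = (0::'a) \<longleftrightarrow> even n"
  by (simp add: of_nat_eq_0_iff_char_dvd CHAR_K)

lemma two_K: "(2::'a) = 0"
  using of_nat_K_eq_0_iff[of 2] by simp

lemma add_self_K [simp]: "(x::'a) + x = 0"
  by (metis mult_2 mult_zero_left two_K)

lemma uminus_K [simp]: "- (x::'a) = x"
  by (metis add_self_K add_eq_0_iff)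

lemma minus_K: "(x::'a) - y = x + y"
  by (metis uminus_K diff_conv_add_uminus)

lemma add_eq_0_K: "(x::'a) + y = 0 \<longleftrightarrow> x = y"
  by (metis minus_K right_minus_eq)

lemma power_q_add: "((x::'a) + y) ^ q = x ^ q + y ^ q"
  by (rule freshmans_dream'[where n=m]) (auto simp: CHAR_K q_def)

lemma power_q_sum: "(\<Sum>i\<in>A. f i :: 'a) ^ q = (\<Sum>i\<in>A. f i ^ q)"
  by (rule freshmans_dream_sum'[where n=m]) (auto simp: CHAR_K q_def)

lemma power_q_q: "((x::'a) ^ q) ^ q = x"
proof (cases "x = 0")
  case False
  have "(x ^ q) ^ q = x ^ CARD('a)"
    by (simp add: CARD_K power2_eq_square flip: power_mult)
  also have "\<dots> = x ^ (CARD('a) - 1) * x"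
    by (rule power_minus_mult[symmetric]) simp
  finally show ?thesis using finite_field_power_card_minus_one[OF False] by simp
qed (use q_ge_2 in auto)

section \<open>The norm-one group \<open>S\<close>, the subfield \<open>F\<close> and the form
  \<open>B\<close>\<close>

lemma card_S: "card S = q + 1"
proof -
  have "(q + 1) * (q - 1) = CARD('a) - 1"
    by (simp add: CARD_K algebra_simps power2_eq_square)
  then show ?thesis
    unfolding unit_circle_def by (rule card_roots_of_unity_finite_field)
qed

lemma S_nonzero: "u \<in> S \<Longrightarrow> u \<noteq> 0"
  by (auto simp: unit_circle_def)

lemma S_mult_conj: "u \<in> S \<Longrightarrow> u * u ^ q = 1"
  by (simp add: unit_circle_def)

lemma power_F:
  assumes "x \<in> F" "x \<noteq> 0"
  shows "x ^ (q - 1) = 1"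
proof -
  have "x * x ^ (q - 1) = x * 1"
    using assms q_ge_2 by (cases q) (auto simp: subfield_F_def)
  then show ?thesis using assms by simp
qed

lemma bform_in_F: "B u x \<in> F"
  by (simp add: subfield_F_def bform_def conj_q_def power_q_add power_mult_distrib power_q_q)

lemma bform_add: "B u (x + y) = B u x + B u y"
  by (simp add: bform_def conj_q_def power_q_add algebra_simps)

lemma bform_0 [simp]: "B u 0 = 0"
  using q_ge_2 by (simp add: bform_def conj_q_def)

lemma ag_line_K: "ag_line q u \<mu> = {x. B u x = \<mu>}"
  by (simp add: ag_line_def add_eq_0_K)

lemma S_mult_bform:
  assumes "u \<in> S"
  shows "u * B u x = u ^ 2 * x ^ q + x"
proof -
  have "u * B u x = u ^ 2 * x ^ q + (u * u ^ q) * x"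
    by (simp add: bform_def conj_q_def algebra_simps power2_eq_square)
  then show ?thesis using S_mult_conj[OF assms] by simp
qed

lemma bform_eq_0_iff:
  assumes "u \<in> S"
  shows "B u x = 0 \<longleftrightarrow> u ^ 2 * x ^ q = x"
  using S_mult_bform[OF assms, of x] S_nonzero[OF assms] add_eq_0_K by (metis mult_eq_0_iff)

lemma square_eq_K: "(x::'a) ^ 2 = y ^ 2 \<longleftrightarrow> x = y"
  by (simp add: power2_eq_iff)

lemma square_image_S: "(\<lambda>u. u ^ 2) ` S = S"
proof (rule endo_inj_surj)
  show "(\<lambda>u. u ^ 2) ` S \<subseteq> S"
  proof
    fix y assume "y \<in> (\<lambda>u. u ^ 2) ` S"
    then obtain u where u: "u ^ (q + 1) = 1" "y = u ^ 2" by (auto simp: unit_circle_def)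
    have "y ^ (q + 1) = (u ^ (q + 1)) ^ 2" unfolding u(2) power_mult[symmetric] by (simp only: mult.commute)
    then show "y \<in> S" using u by (simp add: unit_circle_def)
  qed
qed (auto simp: inj_on_def square_eq_K)

text \<open>The condition says \<open>u ^ 2 = x / x ^ q\<close>, an element of norm one, which has a
  unique square root in \<open>S\<close>. Geometrically, exactly one line through 0 and
  \<open>x\<close> exists, and it determines \<open>u\<close>.\<close>

lemma ex1_direction:
  assumes "x \<noteq> 0"
  shows "\<exists>!u. u \<in> S \<and> B u x = 0"
proof -
  have x: "x ^ q \<noteq> 0" using assms by simp
  have "(x / x ^ q) ^ (q + 1) = 1"
    using assms by (simp add: power_divide power_q_q)
  then have "x / x ^ q \<in> S" by (simp add: unit_circle_def)
  then have "x / x ^ q \<in> (\<lambda>u. u ^ 2) ` S" by (simp only: square_image_S)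
  then obtain u where u: "u \<in> S" "u ^ 2 = x / x ^ q" by (elim imageE) simp
  show ?thesis
  proof (rule ex1I[of _ u])
    show "u \<in> S \<and> B u x = 0" using u x by (simp add: bform_eq_0_iff)
  next
    fix v assume "v \<in> S \<and> B v x = 0"
    then have "v ^ 2 * x ^ q = x" using bform_eq_0_iff by blast
    then have "v ^ 2 = u ^ 2" using u(2) x by (metis nonzero_mult_div_cancel_right)
    then show "v = u" by (simp add: square_eq_K)
  qed
qed

text \<open>For distinct points \<open>y\<close>, \<open>z\<close>, the line joining them belongs to
  the parallel class of \<open>dir (y + z)\<close>. At 0 the value is unspecified, as every
  \<open>u\<close> in \<open>S\<close> qualifies.\<close>

definition dir :: "'a \<Rightarrow> 'a" where
  "dir x = (THE u. u \<in> S \<and> B u x = 0)"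

lemma dir: "x \<noteq> 0 \<Longrightarrow> dir x \<in> S" "x \<noteq> 0 \<Longrightarrow> B (dir x) x = 0"
  using theI'[OF ex1_direction[of x]] by (auto simp: dir_def)

lemma dir_eqI: "x \<noteq> 0 \<Longrightarrow> u \<in> S \<Longrightarrow> B u x = 0 \<Longrightarrow> dir x = u"
  using ex1_direction[of x] dir[of x] by blast

lemma bform_eq_iff: "B u x = B u y \<longleftrightarrow> B u (x + y) = 0"
  by (simp add: bform_add add_eq_0_K)

text \<open>
  Through a point \<open>x\<close> of \<open>A\<close> there are \<open>q + 1\<close> lines and \<open>A\<close> has \<open>q + 1\<close> further points, so joining
  them to \<open>x\<close> gives distinct lines iff it gives all lines.
\<close>
lemma hyperoval_iff_even:
  fixes A :: "'a set"
  assumes A: "card A = q + 2"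
  shows "hyperoval q A \<longleftrightarrow> (\<forall>u\<in>S. \<forall>\<mu>\<in>F. even (card {x \<in> A. B u x = \<mu>}))"
proof
  assume hyp: "hyperoval q A"
  have no3: "y = z" if "x \<in> A" "y \<in> A" "z \<in> A" "x \<noteq> y" "x \<noteq> z" "u \<in> S"
    "B u y = B u x" "B u z = B u x" for u x y z
  proof (rule ccontr)
    assume "y \<noteq> z"
    moreover have "ag_line q u (B u x) \<in> ag_lines q"
      unfolding ag_lines_def using that bform_in_F by blast
    moreover have "{x, y, z} \<subseteq> ag_line q u (B u x)" using that by (simp add: ag_line_K)
    ultimately show False using hyp that unfolding hyperoval_def by blast
  qed
  show "\<forall>u\<in>S. \<forall>\<mu>\<in>F. even (card {x \<in> A. B u x = \<mu>})"
  proof (intro ballI)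
    fix u \<mu> assume u: "u \<in> S"
    show "even (card {x \<in> A. B u x = \<mu>})"
    proof (cases "{x \<in> A. B u x = \<mu>} = {}")
      case False
      then obtain x where x: "x \<in> A" "B u x = \<mu>" by blast
      let ?d = "\<lambda>y. dir (y + x)"
      have d: "?d y \<in> S" "B (?d y) y = B (?d y) x" if "y \<in> A - {x}" for y
        using that dir[of "y + x"] by (auto simp: add_eq_0_K bform_eq_iff)
      have "inj_on ?d (A - {x})"
      proof (rule inj_onI)
        fix y z assume yz: "y \<in> A - {x}" "z \<in> A - {x}" "?d y = ?d z"
        show "y = z"
          by (rule no3[of x y z "?d y"]) (use yz x d[of y] d[of z] in auto)
      qed
      then have "card (?d ` (A - {x})) = card S"
        using A x by (simp add: card_image card_S)
      then have "?d ` (A - {x}) = S"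
        by (intro card_subset_eq) (use d in auto)
      \<comment> \<open>Surjectivity yields a second point on the line; \<open>no3\<close> excludes
        a third.\<close>
      with u have "u \<in> ?d ` (A - {x})" by simp
      then obtain y where y: "y \<in> A - {x}" "?d y = u" by (elim imageE) simp
      have "{x \<in> A. B u x = \<mu>} = {x, y}"
      proof (intro equalityI subsetI)
        fix z assume z: "z \<in> {x \<in> A. B u x = \<mu>}"
        show "z \<in> {x, y}"
          using no3[of x z y u] z x y u d(2)[of y] by auto
      qed (use x y d(2)[of y] in auto)
      then show ?thesis using y by auto
    qed (simp only: card.empty even_zero)
  qed
next
  assume ev: "\<forall>u\<in>S. \<forall>\<mu>\<in>F. even (card {x \<in> A. B u x = \<mu>})"
  have "False" if xyz: "x \<in> A" "y \<in> A" "z \<in> A" "x \<noteq> y" "x \<noteq> z" "y \<noteq> z" "l \<in> ag_lines q" "{x,y,z} \<subseteq> l"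
    for x y z l
  proof -
    obtain u where u: "u \<in> S" "B u y = B u x" "B u z = B u x"
      using xyz by (auto simp: ag_lines_def ag_line_K)
    let ?d = "\<lambda>y. dir (y + x)"
    have "S \<subseteq> ?d ` (A - {x})"
    proof
      fix v assume v: "v \<in> S"
      let ?C = "{w \<in> A. B v w = B v x}"
      have "even (card ?C)" using ev v bform_in_F by blast
      \<comment> \<open>The fibre contains \<open>x\<close> and has even size, hence contains
        another point.\<close>
      then have "?C \<noteq> {x}" by (intro notI) simp
      then obtain w where w: "w \<in> A" "w \<noteq> x" "B v w = B v x" using xyz(1) by blast
      then have "?d w = v" by (intro dir_eqI v) (auto simp: add_eq_0_K bform_eq_iff)
      then show "v \<in> ?d ` (A - {x})" using w by blast
    qed
    then have "card S \<le> card (?d ` (A - {x}))" by (intro card_mono) auto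
    moreover have "card (A - {x}) = card S" using A xyz by (simp add: card_S)
    moreover have "card (?d ` (A - {x})) \<le> card (A - {x})" by (intro card_image_le) auto
    \<comment> \<open>Both sides have \<open>q + 1\<close> elements, so surjectivity forces
      injectivity, contradicting the common direction \<open>u\<close> of \<open>y\<close> and
      \<open>z\<close>.\<close>
    ultimately have "inj_on ?d (A - {x})" by (intro eq_card_imp_inj_on) auto
    moreover have "?d y = u" "?d z = u"
      using u xyz by (auto intro!: dir_eqI simp: add_eq_0_K bform_eq_iff)
    ultimately show False using xyz by (auto dest: inj_onD)
  qed
  then show "hyperoval q A" using A unfolding hyperoval_def by blast
qed

text \<open>
  Modulo 2, the size of the fibre over \<open>\<mu>\<close> is \<open>\<Sum>x. 1 + (f x + \<mu>) ^ (q - 1)\<close>, a combination of power sums.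
\<close>
lemma even_fibres_iff_power_sums:
  fixes f :: "'b \<Rightarrow> 'a"
  assumes "finite A" and f: "f \<in> A \<rightarrow> F"
    and ev: "even (card A)" "even (card {x \<in> A. f x = 0})"
  shows "(\<forall>\<mu>\<in>F. even (card {x \<in> A. f x = \<mu>})) \<longleftrightarrow> (\<forall>k\<in>{1..q-2}. (\<Sum>x\<in>A. f x ^ k) = 0)"
proof
  assume even: "\<forall>\<mu>\<in>F. even (card {x \<in> A. f x = \<mu>})"
  show "\<forall>k\<in>{1..q-2}. (\<Sum>x\<in>A. f x ^ k) = 0"
  proof
    fix k
    have "(\<Sum>x\<in>A. f x ^ k) = (\<Sum>\<mu>\<in>F. \<Sum>x\<in>{x \<in> A. f x = \<mu>}. f x ^ k)"
      using f by (intro sum.group[symmetric] assms) auto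
    also have "\<dots> = (\<Sum>\<mu>\<in>F. of_nat (card {x \<in> A. f x = \<mu>}) * \<mu> ^ k)"
      by (intro sum.cong) auto
    also have "\<dots> = 0"
      using even by (intro sum.neutral) (simp add: of_nat_K_eq_0_iff)
    finally show "(\<Sum>x\<in>A. f x ^ k) = 0" .
  qed
next
  assume ps: "\<forall>k\<in>{1..q-2}. (\<Sum>x\<in>A. f x ^ k) = 0"
  \<comment> \<open>On \<open>F\<close> the power \<open>q - 1\<close> is the indicator of nonzero
    values, so this sum counts the points outside the zero fibre. That number is even by both parity
    assumptions, which is why exponents up to \<open>q - 2\<close> suffice.\<close>
  have "(\<Sum>x\<in>A. f x ^ (q - 1)) = (\<Sum>x\<in>A. if f x = 0 then 0 else 1)"
    using f q_ge_2 by (intro sum.cong) (auto simp: power_F Pi_iff simp del: One_nat_def)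
  also have "\<dots> = of_nat (card {x \<in> A. f x \<noteq> 0})"
    using assms(1) by (simp add: sum.If_cases Int_def)
  also have "\<dots> = 0"
  proof -
    have "card A = card ({x \<in> A. f x = 0} \<union> {x \<in> A. f x \<noteq> 0})"
      by (rule arg_cong[of _ _ card]) auto
    also have "\<dots> = card {x \<in> A. f x = 0} + card {x \<in> A. f x \<noteq> 0}"
      using assms(1) by (intro card_Un_disjoint) auto
    finally show ?thesis using ev by (simp add: of_nat_K_eq_0_iff)
  qed
  finally have top: "(\<Sum>x\<in>A. f x ^ (q - 1)) = 0" .
  have all: "(\<Sum>x\<in>A. f x ^ k) = 0" if k: "k \<le> q - 1" for k
  proof -
    consider "k = 0" | "k = q - 1" | "k \<in> {1..q-2}"
      using k unfolding atLeastAtMost_iff by linarith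
    then show ?thesis using ps top ev(1) by cases (auto simp: of_nat_K_eq_0_iff)
  qed
  show "\<forall>\<mu>\<in>F. even (card {x \<in> A. f x = \<mu>})"
  proof
    fix \<mu> assume \<mu>: "\<mu> \<in> F"
    have "of_nat (card {x \<in> A. f x = \<mu>}) = (\<Sum>x\<in>A. if f x = \<mu> then 1 else 0 :: 'a)"
      using assms(1) by (simp add: sum.If_cases Int_def)
    \<comment> \<open>For \<open>t\<close> in \<open>F\<close>, \<open>1 + t ^ (q - 1)\<close> is 1
      at \<open>t = 0\<close> and \<open>1 + 1 = 0\<close> elsewhere.\<close>
    also have "\<dots> = (\<Sum>x\<in>A. 1 + (f x + \<mu>) ^ (q - 1))"
    proof (intro sum.cong refl)
      fix x assume "x \<in> A"
      then have "f x + \<mu> \<in> F" using f \<mu> by (auto simp: subfield_F_def power_q_add)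
      then show "(if f x = \<mu> then 1 else 0) = 1 + (f x + \<mu>) ^ (q - 1)"
        using power_F[of "f x + \<mu>"] q_ge_2 by (auto simp: add_eq_0_K)
    qed
    \<comment> \<open>The constant terms 1 add up to \<open>card A\<close>, which is 0 in
      characteristic 2.\<close>
    also have "\<dots> = (\<Sum>x\<in>A. \<Sum>k\<le>q-1. of_nat (q - 1 choose k) * f x ^ k * \<mu> ^ (q - 1 - k))"
      using ev(1) by (simp add: sum.distrib binomial_ring of_nat_K_eq_0_iff)
    also have "\<dots> = (\<Sum>k\<le>q-1. of_nat (q - 1 choose k) * \<mu> ^ (q - 1 - k) * (\<Sum>x\<in>A. f x ^ k))"
      by (subst sum.swap) (simp add: sum_distrib_left sum_distrib_right mult_ac)
    also have "\<dots> = 0" by (intro sum.neutral) (simp add: all)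
    finally show "even (card {x \<in> A. f x = \<mu>})" by (simp add: of_nat_K_eq_0_iff)
  qed
qed

section \<open>Power sums of form values as polynomials on \<open>S\<close>\<close>

lemma sum_bform_power:
  assumes "u \<in> S"
  shows "u ^ k * (\<Sum>x\<in>A. B u x ^ k) =
    (\<Sum>i\<le>k. of_nat (k choose i) * (\<Sum>x\<in>A. x ^ (i * q + k - i)) * (u ^ 2) ^ i)"
proof -
  have "u ^ k * (\<Sum>x\<in>A. B u x ^ k) = (\<Sum>x\<in>A. (u ^ 2 * x ^ q + x) ^ k)"
    by (simp add: sum_distrib_left S_mult_bform[OF assms] flip: power_mult_distrib)
  also have "\<dots> = (\<Sum>x\<in>A. \<Sum>i\<le>k. of_nat (k choose i) * x ^ (i * q + k - i) * (u ^ 2) ^ i)"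
  proof (intro sum.cong refl)
    fix x
    have "(u ^ 2 * x ^ q + x) ^ k =
        (\<Sum>i\<le>k. of_nat (k choose i) * (u ^ 2 * x ^ q) ^ i * x ^ (k - i))"
      by (rule binomial_ring)
    also have "\<dots> = (\<Sum>i\<le>k. of_nat (k choose i) * x ^ (i * q + k - i) * (u ^ 2) ^ i)"
    proof (intro sum.cong refl)
      fix i assume "i \<in> {..k}"
      then have "i * q + k - i = q * i + (k - i)" by (simp add: mult.commute)
      then have "x ^ (i * q + k - i) = (x ^ q) ^ i * x ^ (k - i)"
        by (simp only: power_mult power_add)
      then show "of_nat (k choose i) * (u ^ 2 * x ^ q) ^ i * x ^ (k - i) =
          of_nat (k choose i) * x ^ (i * q + k - i) * (u ^ 2) ^ i"
        by (simp add: power_mult_distrib mult_ac)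
    qed
    finally show "(u ^ 2 * x ^ q + x) ^ k =
      (\<Sum>i\<le>k. of_nat (k choose i) * x ^ (i * q + k - i) * (u ^ 2) ^ i)" .
  qed
  finally show ?thesis
    by (subst (asm) sum.swap) (simp add: sum_distrib_left sum_distrib_right)
qed

text \<open>Squaring permutes \<open>S\<close>, so the polynomial in \<open>u\<^sup>2\<close> above has \<open>q + 1\<close> roots, more than its degree.\<close>
lemma sum_bform_power_eq_0_iff:
  assumes "k \<le> q"
  shows "(\<forall>u\<in>S. (\<Sum>x\<in>A. B u x ^ k) = 0) \<longleftrightarrow>
    (\<forall>i\<le>k. i \<preceq>\<^sub>2 k \<longrightarrow> (\<Sum>x\<in>A. x ^ (i * q + k - i)) = 0)"
proof -
  define c where "c i = of_nat (k choose i) * (\<Sum>x\<in>A. x ^ (i * q + k - i))" for i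
  define p where "p = (\<Sum>i\<le>k. monom (c i) i)"
  have coeff: "coeff p i = c i" if "i \<le> k" for i
    using that by (simp add: p_def coeff_sum)
  have "(\<forall>u\<in>S. (\<Sum>x\<in>A. B u x ^ k) = 0) \<longleftrightarrow> (\<forall>u\<in>S. u ^ k * (\<Sum>x\<in>A. B u x ^ k) = 0)"
    \<comment> \<open>The factor \<open>u ^ k\<close> is invertible.\<close>
    using S_nonzero by auto
  also have "\<dots> \<longleftrightarrow> (\<forall>u\<in>S. poly p (u ^ 2) = 0)"
    by (intro ball_cong refl) (simp add: sum_bform_power p_def c_def poly_sum poly_monom)
  also have "\<dots> \<longleftrightarrow> (\<forall>w\<in>S. poly p w = 0)"
    by (subst (2) square_image_S[symmetric]) simp
  also have "\<dots> \<longleftrightarrow> p = 0"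
  proof
    assume "\<forall>w\<in>S. poly p w = 0"
    moreover have "degree p \<le> k"
      unfolding p_def by (intro degree_sum_le) (auto intro: order.trans[OF degree_monom_le])
    ultimately show "p = 0"
      using assms by (intro poly_eqI_degree[of S]) (auto simp: card_S)
  qed simp
  also have "\<dots> \<longleftrightarrow> (\<forall>i\<le>k. c i = 0)"
    using coeff by (auto simp: p_def)
  also have "\<dots> \<longleftrightarrow> (\<forall>i\<le>k. i \<preceq>\<^sub>2 k \<longrightarrow> (\<Sum>x\<in>A. x ^ (i * q + k - i)) = 0)"
    by (auto simp: c_def of_nat_K_eq_0_iff simp flip: odd_choose_iff_bin_le)
  finally show ?thesis .
qed

text \<open>Raising to the power \<open>q\<close> turns the exponent \<open>i * q + (k - i)\<close>
  into \<open>(k - i) * q + i\<close>, because \<open>x\<close> to the power \<open>q ^ 2\<close> is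
  \<open>x\<close>; being additive, this power passes through the sum.\<close>

lemma power_sum_conj:
  assumes "i \<le> k"
  shows "(\<Sum>x\<in>A. x ^ ((k - i) * q + k - (k - i)) :: 'a) = (\<Sum>x\<in>A. x ^ (i * q + k - i)) ^ q"
proof -
  have "x ^ ((k - i) * q + k - (k - i)) = (x ^ (i * q + k - i)) ^ q" for x :: 'a
  proof -
    have "x ^ ((k - i) * q + k - (k - i)) = x ^ ((k - i) * q) * ((x ^ q) ^ q) ^ i"
      using assms by (simp add: power_q_q flip: power_add)
    also have "\<dots> = (x ^ (i * q + (k - i))) ^ q"
      by (simp add: algebra_simps flip: power_mult power_add)
    finally show ?thesis using assms by simp
  qed
  then show ?thesis by (simp add: power_q_sum)
qed

text \<open>Conjugation exchanges \<open>i\<close> and \<open>k - i\<close>, and the self-conjugate index \<open>k / 2\<close> is never \<open>\<preceq>\<^sub>2 k\<close>.\<close>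
lemma power_sums_half:
  assumes "k \<ge> 1"
  shows "(\<forall>i\<le>k. i \<preceq>\<^sub>2 k \<longrightarrow> (\<Sum>x\<in>A. x ^ (i * q + k - i) :: 'a) = 0) \<longleftrightarrow>
    (\<forall>i\<le>(k - 1) div 2. i \<preceq>\<^sub>2 k \<longrightarrow> (\<Sum>x\<in>A. x ^ (i * q + k - i)) = 0)"
    (is "?L \<longleftrightarrow> ?R")
proof
  assume R: ?R
  show ?L
  proof (intro allI impI)
    fix i assume i: "i \<le> k" "i \<preceq>\<^sub>2 k"
    have "k \<noteq> 2 * i"
      using i(2) even_central_choose[of i] assms by (auto simp flip: odd_choose_iff_bin_le)
    \<comment> \<open>The smaller of \<open>i\<close> and \<open>k - i\<close> is strictly below
      half of \<open>k\<close>.\<close>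
    then consider "i \<le> (k - 1) div 2" | "k - i \<le> (k - 1) div 2" by linarith
    then show "(\<Sum>x\<in>A. x ^ (i * q + k - i)) = 0"
    proof cases
      case 1
      then show ?thesis using R i by blast
    next
      case 2
      have "(k - i) \<preceq>\<^sub>2 k"
        using i by (simp flip: odd_choose_iff_bin_le binomial_symmetric)
      then have "(\<Sum>x\<in>A. x ^ ((k - i) * q + k - (k - i))) = 0" using R 2 by blast
      \<comment> \<open>The vanishing sum is the \<open>q\<close>-th power of the wanted
        one.\<close>
      then show ?thesis using power_sum_conj[OF i(1), of A] by simp
    qed
  qed
qed (use assms in auto)

section \<open>The point set \<open>H_set q g\<close>\<close>

context
  fixes g :: "'a \<Rightarrow> 'a"
  assumes g_F: "g \<in> S \<rightarrow> F" and g_nonzero: "\<And>u. u \<in> S \<Longrightarrow> g u \<noteq> 0"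
begin

text \<open>Dividing by the nonzero element \<open>g v\<close> of \<open>F\<close> does not change
  the direction, so the point has the direction of \<open>v\<close> itself, and directions are
  unique. Hence each line through 0 carries exactly one further point of
  \<open>H_set q g\<close>.\<close>

lemma bform_point_eq_0_iff:
  assumes "u \<in> S" "v \<in> S"
  shows "B u (v / g v) = 0 \<longleftrightarrow> u = v"
proof -
  have v: "v \<noteq> 0" "g v \<noteq> 0" "g v ^ q = g v" "v * v ^ q = 1"
    using assms g_nonzero g_F S_nonzero S_mult_conj by (auto simp: subfield_F_def)
  have "B v (v / g v) = 0"
    using v assms by (simp add: bform_eq_0_iff power_divide power2_eq_square mult.assoc)
  then show ?thesis using ex1_direction[of "v / g v"] v assms by auto
qed

lemma inj_on_point: "inj_on (\<lambda>u. u / g u) S"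
  using bform_point_eq_0_iff by (intro inj_onI) metis

lemma H_set_eq: "H_set q g = insert 0 ((\<lambda>u. u / g u) ` S)"
  by (auto simp: H_set_def)

lemma zero_notin_points: "0 \<notin> (\<lambda>u. u / g u) ` S"
  using S_nonzero g_nonzero by auto

lemma card_H_set: "card (H_set q g) = q + 2"
  by (simp add: H_set_eq zero_notin_points card_image inj_on_point card_S)

text \<open>Supplies the even zero fibre that \<open>even_fibres_iff_power_sums\<close>
  assumes.\<close>

lemma card_H_set_bform_0:
  assumes "u \<in> S"
  shows "card {x \<in> H_set q g. B u x = 0} = 2"
proof -
  have "{x \<in> H_set q g. B u x = 0} = {0, u / g u}"
    using assms bform_point_eq_0_iff[OF assms] by (auto simp: H_set_eq)
  then show ?thesis using assms S_nonzero g_nonzero by auto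
qed

text \<open>A positive exponent makes the extra point 0 contribute nothing.\<close>

lemma sum_H_set_power:
  assumes "d > 0"
  shows "(\<Sum>x\<in>H_set q g. x ^ d) = power_sum q g d"
  using assms zero_notin_points
  by (simp add: H_set_eq power_sum_def sum.reindex[OF inj_on_point])

lemma hyperoval_H_set_iff:
  "hyperoval q (H_set q g) \<longleftrightarrow> (\<forall>d\<in>D_set q. power_sum q g d = 0)"
proof -
  let ?H = "H_set q g"
  have "hyperoval q ?H \<longleftrightarrow> (\<forall>u\<in>S. \<forall>\<mu>\<in>F. even (card {x \<in> ?H. B u x = \<mu>}))"
    by (rule hyperoval_iff_even[OF card_H_set])
  also have "\<dots> \<longleftrightarrow> (\<forall>u\<in>S. \<forall>k\<in>{1..q-2}. (\<Sum>x\<in>?H. B u x ^ k) = 0)"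
    by (intro ball_cong refl even_fibres_iff_power_sums)
      (auto simp: bform_in_F card_H_set card_H_set_bform_0 even_q)
  also have "\<dots> \<longleftrightarrow> (\<forall>k\<in>{1..q-2}. \<forall>u\<in>S. (\<Sum>x\<in>?H. B u x ^ k) = 0)"
    by blast
  also have "\<dots> \<longleftrightarrow> (\<forall>k\<in>{1..q-2}. \<forall>i\<le>(k - 1) div 2. i \<preceq>\<^sub>2 k \<longrightarrow> (\<Sum>x\<in>?H. x ^ (i * q + k - i)) = 0)"
  proof (intro ball_cong refl)
    fix k assume k: "k \<in> {1..q-2}"
    then have "k \<le> q" "k \<ge> 1" by auto
    then show "(\<forall>u\<in>S. (\<Sum>x\<in>?H. B u x ^ k) = 0) \<longleftrightarrow>
        (\<forall>i\<le>(k - 1) div 2. i \<preceq>\<^sub>2 k \<longrightarrow> (\<Sum>x\<in>?H. x ^ (i * q + k - i)) = 0)"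
      by (simp only: sum_bform_power_eq_0_iff power_sums_half)
  qed
  also have "\<dots> \<longleftrightarrow> (\<forall>(i, k)\<in>M_set q. power_sum q g (i * q + k - i) = 0)"
  proof -
    have "(\<Sum>x\<in>?H. x ^ (i * q + k - i)) = power_sum q g (i * q + k - i)"
      if "k \<in> {1..q-2}" "i \<le> (k - 1) div 2" for i k
      \<comment> \<open>The exponent is positive because \<open>i < k\<close>.\<close>
      by (rule sum_H_set_power) (use that in auto)
    then show ?thesis by (auto simp: M_set_def)
  qed
  also have "\<dots> \<longleftrightarrow> (\<forall>d\<in>D_set q. power_sum q g d = 0)"
    by (auto simp: D_set_def)
  finally show ?thesis .
qed

end

end

theorem theorem4p5:
  fixes m q :: nat
    and g :: "'a::{field,finite} \<Rightarrow> 'a"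
  assumes "q = 2 ^ m"
    and "CARD('a) = q ^ 2"
    and "g \<in> unit_circle q \<rightarrow> subfield_F q"
    and "\<And>u. u \<in> unit_circle q \<Longrightarrow> g u \<noteq> 0"
  shows "hyperoval q (H_set q g) \<longleftrightarrow> (\<forall>d\<in>D_set q. power_sum q g d = 0)"
proof -
  interpret quadratic_ext "TYPE('a)" m q
    by standard (fact assms)+
  show ?thesis using assms(3,4) by (rule hyperoval_H_set_iff)
qed

end
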